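(* Let $k\ge 1$ and let $\widehat{\mathcal{A}}=(\mathcal{A}_0,\mathcal{A}_1,\dots,\mathcal{A}_k)$ be a tuple of tensors in $\mathbb{T}(m,n)$, where $m$ is even. If $\widehat{\mathcal{A}}$ is an $\mathbb{EHP}$ tensor, then the solution set $\mathrm{SOL}(\widehat{\mathcal{A}},\widehat{\mathbf d},q)$ is nonempty and compact for every tuple $\widehat{\mathbf d}=(d_1,\dots,d_{k-1})$ of vectors in $\mathbb{R}^n_{++}$ and every $q\in\mathbb{R}^n$.
   Context: Let $m,n$ be positive integers. $\mathbb{T}(m,n)$ is the set of real tensors $\mathcal{A}=(a_{i_1\dots i_m})$ of order $m$ and dimension $n$ ($i_1,\dots,i_m\in\{1,\dots,n\}$; no symmetry assumed). For $x\in\mathbb{R}^n$, $\mathcal{A}x^{m-1}\in\mathbb{R}^n$ is defined by $(\mathcal{A}x^{m-1})_i=\sum_{i_2,\dots,i_m=1}^n a_{ii_2\dots i_m}x_{i_2}\cdots x_{i_m}$. $x\wedge y$ is the componentwise minimum, $x\ast y$ the componentwise product, and vector inequalities are componentwise. $\mathbb{R}^n_{++}$ is the set of vectors with all components $>0$. Write $[k]=\{1,\dots,k\}$. $\mathrm{SOL}(\widehat{\mathcal{A}},\widehat{\mathbf d},q)$ is the set of $(x_0,x_1,\dots,x_k)\in(\mathbb{R}^n)^{k+1}$ such that $\mathcal{A}_0x_0^{m-1}=q+\sum_{j=1}^k\mathcal{A}_jx_j^{m-1}$, $x_0\wedge x_1=0$, and $(d_j-x_j)\wedge x_{j+1}=0$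 for $j\in[k-1]$ (if $k=1$, $\widehat{\mathbf d}$ is the empty tuple and the last conditions are void). $\widehat{\mathcal{A}}$ is an $\mathbb{EHP}$ tensor if the only $(x_0,\dots,x_k)\in(\mathbb{R}^n)^{k+1}$ with $\mathcal{A}_0x_0^{m-1}=\sum_{j=1}^k\mathcal{A}_jx_j^{m-1}$ and $x_0\ast x_i\le 0$ for all $i\in[k]$ is $x_0=x_1=\dots=x_k=0$. *)

theory Defs
  imports "HOL-Analysis.Analysis"
begin

text \<open>
  A tensor of order \<open>m\<close> and dimension \<open>CARD('n)\<close> is a real function of index lists
  \<open>[i\<^sub>1, \<dots>, i\<^sub>m]\<close>. Being 0 on lists of any other length makes the representation unique.
\<close>

definition tensors :: "nat \<Rightarrow> ('n::finite list \<Rightarrow> real) set" where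
  "tensors m = {A. \<forall>is. length is \<noteq> m \<longrightarrow> A is = 0}"

text \<open>The vector \<open>\<A>x\<^bsup>m-1\<^esup>\<close>; the list \<open>is\<close> stands for \<open>[i\<^sub>2, \<dots>, i\<^sub>m]\<close>.\<close>

definition tensor_apply :: "nat \<Rightarrow> ('n::finite list \<Rightarrow> real) \<Rightarrow> real ^ 'n \<Rightarrow> real ^ 'n" where
  "tensor_apply m A x =
    (\<chi> i. \<Sum>is | length is = m - 1. A (i # is) * prod_list (map (\<lambda>j. x $ j) is))"

text \<open>
  The strict order of type \<open>real ^ 'n\<close> is not the componentwise one, so it is spelled out here.
  In contrast, \<open>\<le>\<close>, \<open>inf\<close> and \<open>*\<close> on \<open>real ^ 'n\<close> are the componentwise order,
  minimum and product.
\<close>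

definition pos_vecs :: "(real ^ 'n::finite) set" where
  "pos_vecs = {x. \<forall>i. 0 < x $ i}"

text \<open>
  A tuple \<open>(x\<^sub>0, \<dots>, x\<^sub>k)\<close> is a function on \<open>nat\<close> that is \<open>undefined\<close> outside
  \<open>{..k}\<close>; the topology of the \<open>(k+1)\<close>-fold power is the product topology over \<open>{..k}\<close>,
  whose carrier is exactly this set.
\<close>

abbreviation vec_tuples :: "nat \<Rightarrow> (nat \<Rightarrow> real ^ 'n::finite) set" where
  "vec_tuples k \<equiv> {..k} \<rightarrow>\<^sub>E UNIV"

abbreviation vec_tuples_topology :: "nat \<Rightarrow> (nat \<Rightarrow> real ^ 'n::finite) topology" where
  "vec_tuples_topology k \<equiv> product_topology (\<lambda>_. euclidean) {..k}"

definition SOL ::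
  "nat \<Rightarrow> nat \<Rightarrow> (nat \<Rightarrow> 'n::finite list \<Rightarrow> real) \<Rightarrow> (nat \<Rightarrow> real ^ 'n) \<Rightarrow> real ^ 'n
    \<Rightarrow> (nat \<Rightarrow> real ^ 'n) set" where
  "SOL m k A d q = {x \<in> vec_tuples k.
      tensor_apply m (A 0) (x 0) = q + (\<Sum>j = 1..k. tensor_apply m (A j) (x j)) \<and>
      inf (x 0) (x 1) = 0 \<and>
      (\<forall>j \<in> {1..k - 1}. inf (d j - x j) (x (j + 1)) = 0)}"

definition EHP_tensor :: "nat \<Rightarrow> nat \<Rightarrow> (nat \<Rightarrow> 'n::finite list \<Rightarrow> real) \<Rightarrow> bool" where
  "EHP_tensor m k A \<longleftrightarrow>
    (\<forall>x \<in> vec_tuples k.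
      tensor_apply m (A 0) (x 0) = (\<Sum>j = 1..k. tensor_apply m (A j) (x j)) \<and>
      (\<forall>i \<in> {1..k}. x 0 * x i \<le> 0)
      \<longrightarrow> (\<forall>i \<in> {0..k}. x i = 0))"

end

theory Submission
  imports Defs "HOL-Homology.Simplices"
begin

text \<open>
  In one coordinate, the complementarity conditions say that \<open>(x\<^sub>0, \<dots>, x\<^sub>k)\<close> lies on a polygonal
  path: at most \<open>x\<^sub>0\<close> is nonzero, or \<open>x\<^sub>0 = 0\<close> and \<open>x\<^sub>1\<close> grows to \<open>d\<^sub>1\<close>, then \<open>x\<^sub>2\<close> grows to
  \<open>d\<^sub>2\<close>, and so on, until \<open>x\<^sub>k\<close> grows without bound. The path is parametrised by the real line, so
  the solutions of the system come from the zeros of a continuous map \<open>F(t) - q\<close> of \<open>\<real>\<^sup>n\<close> into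
  itself, where \<open>F(t) = \<A>\<^sub>0x\<^sub>0(t)\<^bsup>m-1\<^esup> - \<Sum>\<^sub>j \<A>\<^sub>jx\<^sub>j(t)\<^bsup>m-1\<^esup>\<close>.

  By homogeneity and compactness of the unit sphere, the EHP property is a coercivity estimate
  (\<open>EHP_tensor_coercive\<close>): on all tuples with \<open>x\<^sub>0 * x\<^sub>j \<le> 0\<close>, the residual
  \<open>\<A>\<^sub>0x\<^sub>0\<^bsup>m-1\<^esup> - \<Sum>\<^sub>j \<A>\<^sub>jx\<^sub>j\<^bsup>m-1\<^esup>\<close> is at least a positive
  constant times the \<open>(m-1)\<close>-st power of the size of the tuple. Every
  solution satisfies these sign conditions, because \<open>d > 0\<close> forces \<open>x\<^sub>1 = \<dots> = x\<^sub>k = 0\<close> wherever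
  \<open>x\<^sub>0 > 0\<close>. So the solution set is bounded; it is closed, hence compact.

  For existence, the path is deformed linearly into the tuple \<open>(-t, 0, \<dots>, 0)\<close>. All intermediate
  tuples satisfy the sign conditions, so the coercivity estimate keeps the zeros of the deformed
  maps in one ball. At the end of the deformation the map is \<open>\<A>\<^sub>0(-t)\<^bsup>m-1\<^esup>\<close>, which is odd because
  \<open>m\<close> is even. Performing the deformation while \<open>t\<close> moves radially through a shell around that
  ball yields a continuous map that equals \<open>F(t) - q\<close> in the ball and is odd on the outer
  sphere. By the Borsuk-Ulam theorem in the form \<open>borsuk_ulam_ball\<close> it has a zero, and the zero can
  only lie in the ball.

  The Borsuk-Ulam theorem is derived from a covering form of Tucker's lemma (\<open>tucker_cover\<close>), which
  is Ky Fan's parity argument carried out on singular chains. The cochains that count simplices whose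
  labels alternate in sign satisfy \<open>\<delta>\<alpha>\<^sub>p = \<alpha>\<^sub>p\<^sub>+\<^sub>1 + \<alpha>'\<^sub>p\<^sub>+\<^sub>1\<close> modulo 2, where \<open>\<alpha>'\<close> starts with the
  other sign, and the antipodal map exchanges \<open>\<alpha>\<close> and \<open>\<alpha>'\<close>. Evaluated on finely subdivided
  hemispheres, each bounded by a hemisphere of one dimension less and its antipode, this carries
  oddness from a point up to dimension \<open>n\<close>, where \<open>n\<close> label values are too few for an alternating
  list of \<open>n + 1\<close> labels.
\<close>

section \<open>Parity of alternating label lists\<close>


text \<open>
  A label \<open>2 * i + s\<close> with \<open>s \<in> {0, 1}\<close> encodes the signed index \<open>+i\<close> or \<open>-i\<close>. This way the parity is
  the sign, \<open>div 2\<close> is the index, and the order of \<open>nat\<close> sorts labels by index.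
\<close>

definition flip :: "nat \<Rightarrow> nat" where
  "flip a = (if even a then Suc a else a - 1)"

definition complement_free :: "nat set \<Rightarrow> bool" where
  "complement_free S \<longleftrightarrow> (\<forall>a\<in>S. flip a \<notin> S)"

lemma complement_free_subset: "complement_free T \<Longrightarrow> S \<subseteq> T \<Longrightarrow> complement_free S"
  unfolding complement_free_def by (meson subsetD)

fun alternating :: "bool \<Rightarrow> nat list \<Rightarrow> bool" where
  "alternating b [] \<longleftrightarrow> True"
| "alternating b (a # as) \<longleftrightarrow> odd a = b \<and> alternating (\<not> b) as"

definition omit :: "nat \<Rightarrow> 'a list \<Rightarrow> 'a list" where
  "omit k xs = take k xs @ drop (Suc k) xs"

lemma omit_Cons [simp]: "omit 0 (x # xs) = xs" "omit (Suc k) (x # xs) = x # omit k xs"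
  by (simp_all add: omit_def)

lemma sorted_omit: "sorted xs \<Longrightarrow> sorted (omit k xs)"
  by (induction xs arbitrary: k)
    (auto simp: omit_def sorted_append dest!: in_set_takeD in_set_dropD split: nat.splits
      simp: take_Cons drop_Cons)

lemma mset_omit:
  assumes "k < length xs"
  shows "mset (omit k xs) = mset xs - {#xs ! k#}"
proof -
  have "mset xs = mset (take k xs @ xs ! k # drop (Suc k) xs)"
    using id_take_nth_drop[OF assms] by simp
  then show ?thesis
    by (simp add: omit_def)
qed

lemma sum_omit_mset:
  fixes F :: "'a multiset \<Rightarrow> 'b::comm_monoid_add"
  shows "(\<Sum>k<length xs. F (mset (omit k xs))) = (\<Sum>x\<in>#mset xs. F (mset xs - {#x#}))"
proof -
  have "(\<Sum>k<length xs. F (mset (omit k xs))) = (\<Sum>k<length xs. F (mset xs - {#xs ! k#}))"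
    by (intro sum.cong) (simp_all add: mset_omit)
  also have "\<dots> = sum_list (map (\<lambda>x. F (mset xs - {#x#})) xs)"
    by (simp add: sum_list_sum_nth atLeast0LessThan)
  also have "\<dots> = (\<Sum>x\<in>#mset xs. F (mset xs - {#x#}))"
    by (metis mset_map sum_mset_sum_list)
  finally show ?thesis .
qed

text \<open>
  Modulo 2 the sum telescopes. If the first label \<open>a\<close> has the sign \<open>b\<close>, the list without \<open>a\<close> and
  the induction hypothesis both contribute the alternation of the tail that starts with \<open>b\<close>, and
  these cancel. If not, only the list without \<open>a\<close> can alternate starting with \<open>b\<close>.
\<close>

lemma even_sum_alternating_omit:
  "even ((\<Sum>k<length as. of_bool (alternating b (omit k as)) :: int)
         + of_bool (alternating b as) + of_bool (alternating (\<not> b) as))"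
proof (induction as arbitrary: b)
  case (Cons a as)
  have "(\<Sum>k<length (a # as). of_bool (alternating b (omit k (a # as))) :: int)
      = of_bool (alternating b as)
        + (if odd a = b then \<Sum>k<length as. of_bool (alternating (\<not> b) (omit k as)) else 0)"
    by (simp add: sum.lessThan_Suc_shift del: sum.lessThan_Suc)
  then show ?case
    using Cons.IH[of "\<not> b"] by (auto simp: of_bool_def split: if_splits)
qed simp

text \<open>
  Vertices of a simplex come in an arbitrary order, so alternation is only meaningful after sorting.
  The faces of the sorted list are the sorted faces up to order, since both are given by removing one
  element from the same multiset.
\<close>

lemma even_sum_sort_alternating_omit:
  "even ((\<Sum>k<length as. of_bool (alternating b (sort (omit k as))) :: int)
         + of_bool (alternating b (sort as)) + of_bool (alternating (\<not> b) (sort as)))"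
proof -
  let ?F = "\<lambda>M. of_bool (alternating b (sorted_list_of_multiset M)) :: int"
  have "(\<Sum>k<length as. ?F (mset (omit k as))) = (\<Sum>k<length (sort as). ?F (mset (omit k (sort as))))"
    unfolding sum_omit_mset[of ?F] by (simp del: sum_of_bool_eq)
  moreover have "sort (omit k (sort as)) = omit k (sort as)" for k
    by (simp add: sorted_omit sorted_sort_id)
  ultimately show ?thesis
    using even_sum_alternating_omit[where as = "sort as" and b = b] by (simp del: sum_of_bool_eq)
qed

lemma alternating_flip: "alternating b (map flip as) \<longleftrightarrow> alternating (\<not> b) as"
  by (induction as arbitrary: b) (auto simp: flip_def)

lemma flip_mono:
  assumes "a \<le> b" "b \<noteq> flip a"
  shows "flip a \<le> flip b"
proof (cases "a = b")
  case False
  with assms have "a div 2 < b div 2"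
    unfolding flip_def by (cases "even a"; cases "even b") (auto elim!: evenE oddE)
  moreover have "flip c div 2 = c div 2" for c
    by (auto simp: flip_def elim!: oddE)
  ultimately have "flip a div 2 < flip b div 2"
    by simp
  then show ?thesis
    using div_le_mono[of "flip b" "flip a" 2] by linarith
qed simp

text \<open>
  Changing all signs can disturb the sorted order only between two labels of the same index, and these
  are equal when no complementary pair occurs.
\<close>

lemma sort_map_flip:
  assumes "complement_free (set as)"
  shows "sort (map flip as) = map flip (sort as)"
proof -
  have "sorted_wrt (\<lambda>a b. flip a \<le> flip b) (sort as)"
    using sorted_sort[of as]
  proof (rule sorted_wrt_mono_rel[rotated])
    show "flip a \<le> flip b" if "a \<in> set (sort as)" "b \<in> set (sort as)" "a \<le> b" for a b
      using that assms flip_mono by (auto simp: complement_free_def)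
  qed
  then have "sorted (map flip (sort as))"
    by (simp add: sorted_wrt_map)
  moreover have "sort (map flip as) = sort (map flip (sort as))"
    by (metis mset_map mset_sort sorted_list_of_multiset_mset)
  ultimately show ?thesis
    by (simp add: sorted_sort_id)
qed

lemma sorted_alternating_increasing:
  assumes "sorted as" "alternating b as" "complement_free (set as)"
  shows "sorted_wrt (<) (map (\<lambda>a. a div 2) as)"
  using assms
proof (induction as arbitrary: b)
  case (Cons a as)
  then have IH: "sorted_wrt (<) (map (\<lambda>a. a div 2) as)"
    by (auto simp: complement_free_def)
  show ?case
  proof (cases as)
    case (Cons a' as')
    have "a \<le> a'" "a' \<noteq> flip a" "odd a \<noteq> odd a'"
      using Cons.prems Cons by (auto simp: complement_free_def)
    then have "a div 2 < a' div 2"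
      unfolding flip_def by (cases "even a"; cases "even a'") (auto elim!: evenE oddE)
    with IH Cons show ?thesis
      by (auto intro: less_trans)
  qed simp
qed simp

text \<open>
  In a sorted alternating list, neighbours with the same index would have opposite signs and hence be
  complementary. So the indices increase strictly.
\<close>

lemma alternating_length_le:
  assumes "sorted as" "alternating b as" "complement_free (set as)"
    and "\<And>a. a \<in> set as \<Longrightarrow> a div 2 < n"
  shows "length as \<le> n"
proof -
  let ?ds = "map (\<lambda>a. a div 2) as"
  have "distinct ?ds"
    using sorted_alternating_increasing[OF assms(1-3)] strict_sorted_iff by blast
  then have "length as = card (set ?ds)"
    using distinct_card by fastforce
  also have "\<dots> \<le> card {..<n}"
    using assms(4) by (intro card_mono) auto
  finally show ?thesis
    by simp
qed

section \<open>Alternation as a cochain, hemispheres and the covering form of Tucker's lemma\<close>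


text \<open>
  The value of an integral cochain on a chain. Extending into the free abelian group on one generator
  makes additivity an instance of the additivity of \<open>frag_extend\<close>.
\<close>

definition pairing :: "('s \<Rightarrow> int) \<Rightarrow> ('s \<Rightarrow>\<^sub>0 int) \<Rightarrow> int" where
  "pairing \<phi> c = Poly_Mapping.lookup (frag_extend (\<lambda>f. frag_cmul (\<phi> f) (frag_of ())) c) ()"

lemma pairing_0 [simp]: "pairing \<phi> 0 = 0"
  by (simp add: pairing_def)

lemma pairing_frag_of [simp]: "pairing \<phi> (frag_of f) = \<phi> f"
  by (simp add: pairing_def)

lemma pairing_add: "pairing \<phi> (c + d) = pairing \<phi> c + pairing \<phi> d"
  by (simp add: pairing_def frag_extend_add lookup_add)

lemma pairing_diff: "pairing \<phi> (c - d) = pairing \<phi> c - pairing \<phi> d"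
  by (simp add: pairing_def frag_extend_diff lookup_minus)

lemma pairing_cmul: "pairing \<phi> (frag_cmul a c) = a * pairing \<phi> c"
  by (simp add: pairing_def frag_extend_cmul)

lemma pairing_sum: "pairing \<phi> (sum g I) = (\<Sum>i\<in>I. pairing \<phi> (g i))"
  by (induction I rule: infinite_finite_induct) (simp_all add: pairing_add)

lemma pairing_cong:
  assumes "\<And>f. f \<in> Poly_Mapping.keys c \<Longrightarrow> \<phi> f = \<psi> f"
  shows "pairing \<phi> c = pairing \<psi> c"
  unfolding pairing_def by (subst frag_extend_eq[where h = "\<lambda>f. frag_cmul (\<psi> f) (frag_of ())"]) (simp_all add: assms)

lemma pairing_eq_0:
  assumes "\<And>f. f \<in> Poly_Mapping.keys c \<Longrightarrow> \<phi> f = 0"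
  shows "pairing \<phi> c = 0"
  using assms by (simp add: pairing_def frag_extend_eq_0)

lemma pairing_chain_map: "pairing \<phi> (chain_map p g c) = pairing (\<phi> \<circ> simplex_map p g) c"
  using subset_UNIV
  by (induction c rule: frag_induction) (simp_all add: chain_map_diff pairing_diff)

definition vertex_labels :: "('a \<Rightarrow> nat) \<Rightarrow> nat \<Rightarrow> ((nat \<Rightarrow> real) \<Rightarrow> 'a) \<Rightarrow> nat list" where
  "vertex_labels l p f = map (\<lambda>i. l (f (\<lambda>j. if j = i then 1 else 0))) [0..<Suc p]"

text \<open>
  The indicator cochain of the simplices whose sorted vertex labels alternate in sign, starting with
  a negative one if \<open>b\<close> holds.
\<close>

definition alternation :: "bool \<Rightarrow> ('a \<Rightarrow> nat) \<Rightarrow> nat \<Rightarrow> ((nat \<Rightarrow> real) \<Rightarrow> 'a) \<Rightarrow> int" where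
  "alternation b l p f = of_bool (alternating b (sort (vertex_labels l p f)))"

lemma length_vertex_labels [simp]: "length (vertex_labels l p f) = Suc p"
  by (simp add: vertex_labels_def)

lemma set_vertex_labels: "set (vertex_labels l p f) \<subseteq> l ` f ` standard_simplex p"
proof -
  have "(\<lambda>j. if j = i then 1 else 0) \<in> standard_simplex p" if "i \<le> p" for i
    using that by simp
  then show ?thesis
    by (auto simp: vertex_labels_def simp del: upt_Suc)
qed

lemma nth_omit: "i < length xs - 1 \<Longrightarrow> omit k xs ! i = xs ! (if i < k then i else Suc i)"
  by (auto simp: omit_def nth_append)

lemma vertex_labels_singular_face:
  assumes "k \<le> Suc p"
  shows "vertex_labels l p (singular_face (Suc p) k f) = omit k (vertex_labels l (Suc p) f)"
proof (rule nth_equalityI)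
  show "length (vertex_labels l p (singular_face (Suc p) k f)) = length (omit k (vertex_labels l (Suc p) f))"
    using assms by (simp add: omit_def)
  fix i assume "i < length (vertex_labels l p (singular_face (Suc p) k f))"
  then have i: "i \<le> p"
    by simp
  have "simplical_face k (\<lambda>j. if j = i then 1 else (0::real))
      = (\<lambda>j. if j = (if i < k then i else Suc i) then 1 else 0)"
    using i assms by (auto simp: simplical_face_def fun_eq_iff)
  then show "vertex_labels l p (singular_face (Suc p) k f) ! i = omit k (vertex_labels l (Suc p) f) ! i"
    using i assms
    by (simp add: nth_omit vertex_labels_def singular_face_def del: upt_Suc)
qed

text \<open>
  The signs in the boundary operator are irrelevant modulo 2.
\<close>

lemma even_signed_sum_plus_sum:
  "even ((\<Sum>k\<in>I. (-1) ^ k * x k) + (\<Sum>k\<in>I. (x k :: int)))"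
proof -
  have "(\<Sum>k\<in>I. (-1) ^ k * x k) + (\<Sum>k\<in>I. x k) = (\<Sum>k\<in>I. ((-1) ^ k + 1) * x k)"
    by (simp add: sum.distrib algebra_simps)
  also have "even \<dots>"
    by (intro dvd_sum) auto
  finally show ?thesis .
qed

text \<open>
  The faces of a simplex omit one vertex label each, so on a single simplex this is the parity of
  alternating label lists with one label omitted.
\<close>

lemma alternation_coboundary:
  "even (pairing (alternation b l p) (chain_boundary (Suc p) c)
         + pairing (alternation b l (Suc p)) c + pairing (alternation (\<not> b) l (Suc p)) c)"
  using subset_UNIV
proof (induction c rule: frag_induction)
  case (one f)
  have "pairing (alternation b l p) (chain_boundary (Suc p) (frag_of f))
      = (\<Sum>k\<le>Suc p. (-1) ^ k * alternation b l p (singular_face (Suc p) k f))"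
    by (simp add: chain_boundary_of pairing_sum pairing_cmul del: sum.atMost_Suc)
  moreover have "(\<Sum>k\<le>Suc p. alternation b l p (singular_face (Suc p) k f))
      = (\<Sum>k<length (vertex_labels l (Suc p) f). of_bool (alternating b (sort (omit k (vertex_labels l (Suc p) f)))))"
    by (intro sum.cong) (auto simp: alternation_def vertex_labels_singular_face)
  ultimately show ?case
    using even_sum_sort_alternating_omit[where as = "vertex_labels l (Suc p) f" and b = b]
      even_signed_sum_plus_sum[of "\<lambda>k. alternation b l p (singular_face (Suc p) k f)" "{..Suc p}"]
    by (simp add: alternation_def[of _ _ "Suc p"] del: sum.atMost_Suc sum_of_bool_eq)
next
  case (diff c d)
  from dvd_diff[OF this] show ?case
    by (simp only: chain_boundary_diff pairing_diff) (simp add: algebra_simps)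
qed simp

abbreviation (input) neg :: "(nat \<Rightarrow> real) \<Rightarrow> nat \<Rightarrow> real" where
  "neg x \<equiv> \<lambda>i. - x i"

lemma alternation_antipode:
  assumes "\<And>x. x \<in> S \<Longrightarrow> l (neg x) = flip (l x)" "f ` standard_simplex p \<subseteq> S"
    and "complement_free (l ` f ` standard_simplex p)"
  shows "alternation b l p (simplex_map p neg f) = alternation (\<not> b) l p f"
proof -
  let ?e = "\<lambda>i j. if j = i then 1 else (0 :: real)"
  have "l (simplex_map p neg f (?e i)) = flip (l (f (?e i)))" if "i \<le> p" for i
  proof -
    have e: "?e i \<in> standard_simplex p"
      using that by simp
    then have "f (?e i) \<in> S"
      using assms(2) by blast
    from assms(1)[OF this] e show ?thesis
      by (simp only: simplex_map_def restrict_apply comp_apply if_True)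
  qed
  then have "vertex_labels l p (simplex_map p neg f) = map flip (vertex_labels l p f)"
    unfolding vertex_labels_def map_map by (intro map_cong) (simp_all del: upt_Suc)
  moreover have "complement_free (set (vertex_labels l p f))"
    using assms(3) set_vertex_labels by (rule complement_free_subset)
  ultimately show ?thesis
    by (simp add: alternation_def sort_map_flip alternating_flip)
qed

text \<open>
  The unit sphere of the \<open>l\<^sub>1\<close>-norm on the first \<open>p + 1\<close> coordinates. Unlike a round sphere, it
  contains the segments from the next unit vector to its points, so hemispheres can be built as cones
  of affine simplices.
\<close>

definition octahedral_sphere :: "nat \<Rightarrow> (nat \<Rightarrow> real) set" where
  "octahedral_sphere p = {x. (\<Sum>i\<le>p. \<bar>x i\<bar>) = 1 \<and> (\<forall>i>p. x i = 0)}"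

lemma octahedral_sphere_mono:
  assumes "p \<le> q"
  shows "octahedral_sphere p \<subseteq> octahedral_sphere q"
proof
  fix x assume x: "x \<in> octahedral_sphere p"
  have "(\<Sum>i\<le>q. \<bar>x i\<bar>) = (\<Sum>i\<le>p. \<bar>x i\<bar>)"
    using x assms by (intro sum.mono_neutral_right) (auto simp: octahedral_sphere_def)
  then show "x \<in> octahedral_sphere q"
    using x assms by (auto simp: octahedral_sphere_def)
qed

text \<open>
  The hemisphere of dimension \<open>p + 1\<close> is the cone, with apex the next unit vector, over the sphere of
  dimension \<open>p\<close>, which consists of the hemisphere of dimension \<open>p\<close> and its antipode. The alternating
  sign makes that sphere a cycle.
\<close>

primrec hemisphere :: "nat \<Rightarrow> (nat \<Rightarrow> real) chain" where
  "hemisphere 0 = frag_of (oriented_simplex 0 (\<lambda>_ j. if j = 0 then 1 else 0))"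
| "hemisphere (Suc p) = simplicial_cone p (\<lambda>j. if j = Suc p then 1 else 0)
     (hemisphere p + frag_cmul ((-1) ^ Suc p) (chain_map p neg (hemisphere p)))"

abbreviation equator :: "nat \<Rightarrow> (nat \<Rightarrow> real) chain" where
  "equator p \<equiv> hemisphere p + frag_cmul ((-1) ^ Suc p) (chain_map p neg (hemisphere p))"

lemma simplicial_chain_neg:
  assumes "simplicial_chain p S c" "\<And>x. x \<in> S \<Longrightarrow> neg x \<in> S"
  shows "simplicial_chain p S (chain_map p neg c)"
  using assms(1) unfolding simplicial_chain_def
proof (induction c rule: frag_induction)
  case (one f)
  then obtain m where f: "f = oriented_simplex p m" "f ` standard_simplex p \<subseteq> S"
    by (auto simp: simplicial_simplex)
  have "simplex_map p neg f = oriented_simplex p (\<lambda>j i. - m j i)"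
    unfolding f(1) simplex_map_def oriented_simplex_def by (intro ext) (simp add: restrict_def sum_negf)
  moreover have "simplex_map p neg f ` standard_simplex p \<subseteq> S"
    using f(2) assms(2) by (simp add: simplex_map_def image_subset_iff)
  ultimately have "simplicial_simplex p S (simplex_map p neg f)"
    unfolding simplicial_simplex by blast
  then show ?case
    by simp
next
  case (diff a b)
  then show ?case
    using simplicial_chain_diff[of p S "chain_map p neg a" "chain_map p neg b"]
    by (simp add: chain_map_diff simplicial_chain_def)
qed simp

lemma simplicial_chain_equator:
  assumes "simplicial_chain p (octahedral_sphere p) (hemisphere p)"
  shows "simplicial_chain p (octahedral_sphere p) (equator p)"
proof -
  have "simplicial_chain p (octahedral_sphere p) (chain_map p neg (hemisphere p))"
    using assms by (rule simplicial_chain_neg) (auto simp: octahedral_sphere_def)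
  then have "simplicial_chain p (octahedral_sphere p)
     (hemisphere p - frag_cmul (- ((-1) ^ Suc p)) (chain_map p neg (hemisphere p)))"
    by (intro simplicial_chain_diff simplicial_chain_cmul assms)
  then show ?thesis
    by (simp flip: minus_frag_cmul)
qed

lemma simplicial_chain_hemisphere:
  "simplicial_chain p (octahedral_sphere p) (hemisphere p)"
proof (induction p)
  case 0
  show ?case
    by (auto simp: simplicial_simplex_oriented_simplex octahedral_sphere_def standard_simplex_0)
next
  case (Suc p)
  show ?case
    unfolding hemisphere.simps
  proof (rule simplicial_chain_simplicial_cone[OF simplicial_chain_equator[OF Suc]])
    fix x :: "nat \<Rightarrow> real" and u :: real
    assume u: "0 \<le> u" "u \<le> 1" and x: "x \<in> octahedral_sphere p"
    have "(\<Sum>i\<le>p. \<bar>(1 - u) * (if i = Suc p then 1 else 0) + u * x i\<bar>) = (\<Sum>i\<le>p. u * \<bar>x i\<bar>)"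
      using u by (intro sum.cong) (auto simp: abs_mult)
    also have "\<dots> = u"
      using x by (simp add: octahedral_sphere_def flip: sum_distrib_left)
    finally show "(\<lambda>i. (1 - u) * (if i = Suc p then 1 else 0) + u * x i) \<in> octahedral_sphere (Suc p)"
      using u x by (simp add: octahedral_sphere_def)
  qed
qed

lemma singular_chain_hemisphere:
  "singular_chain p (subtopology (powertop_real UNIV) (octahedral_sphere p)) (hemisphere p)"
  by (simp add: simplicial_chain_hemisphere simplicial_imp_singular_chain)

lemma chain_map_neg_neg:
  assumes "singular_chain p X c"
  shows "chain_map p neg (chain_map p neg c) = c"
proof -
  have "chain_map p neg (chain_map p neg c) = chain_map p (neg \<circ> neg) c"
    by (simp add: chain_map_compose)
  also have "\<dots> = c"
    using assms by (rule chain_map_id_gen) simp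
  finally show ?thesis .
qed

text \<open>
  The boundary of a cone over a cycle is the cycle itself. The chain \<open>equator p\<close> is a cycle since
  \<open>\<partial>\<close> commutes with the antipodal map and \<open>equator (p - 1)\<close> is mapped to \<open>\<plusminus> equator (p - 1)\<close>
  by it, with the sign opposite to the one used in \<open>equator p\<close>.
\<close>

lemma chain_boundary_hemisphere: "chain_boundary (Suc p) (hemisphere (Suc p)) = equator p"
proof (induction p)
  case 0
  have "chain_boundary (Suc 0) (hemisphere (Suc 0)) = equator 0
      - frag_extend (\<lambda>f. frag_of (\<lambda>u\<in>standard_simplex 0. (\<lambda>j. if j = Suc 0 then 1 else 0))) (equator 0)"
    using chain_boundary_simplicial_cone[OF simplicial_chain_equator[OF simplicial_chain_hemisphere[of 0]]]
    by (simp only: hemisphere.simps(2)) simp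
  then show ?case
    by (simp add: frag_extend_diff)
next
  case (Suc p)
  let ?h = "hemisphere p" and ?s = "(-1) ^ p :: int"
  have "chain_boundary (Suc p) (chain_map (Suc p) neg (hemisphere (Suc p)))
      = chain_map p neg (equator p)"
    using chain_boundary_chain_map[OF singular_chain_hemisphere[of "Suc p"], of neg] Suc by simp
  also have "\<dots> = chain_map p neg ?h + frag_cmul ((-1) ^ Suc p) ?h"
    by (simp only: chain_map_add chain_map_cmul chain_map_neg_neg[OF singular_chain_hemisphere[of p]])
  finally have "chain_boundary (Suc p) (equator (Suc p))
      = equator p + frag_cmul ((-1) ^ Suc (Suc p)) (chain_map p neg ?h + frag_cmul ((-1) ^ Suc p) ?h)"
    unfolding chain_boundary_add chain_boundary_cmul Suc by (rule arg_cong)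
  also have "\<dots> = 0"
    by (cases "even p") simp_all
  finally have "chain_boundary (Suc p) (equator (Suc p)) = 0" .
  then show ?case
    using chain_boundary_simplicial_cone[OF simplicial_chain_equator[OF simplicial_chain_hemisphere[of "Suc p"]]]
    unfolding hemisphere.simps(2)[of "Suc p"] by (simp add: simplicial_cone_def del: hemisphere.simps)
qed

text \<open>
  Subdivision preserves the boundary relation between hemispheres because it commutes with boundaries
  and with the antipodal map.
\<close>

lemma singular_chain_iterated_subdivision:
  "singular_chain p X c \<Longrightarrow> singular_chain p X ((singular_subdivision p ^^ N) c)"
  by (induction N) (simp_all add: singular_chain_singular_subdivision)

lemma chain_boundary_iterated_subdivision:
  assumes "singular_chain p X c"
  shows "chain_boundary p ((singular_subdivision p ^^ N) c)
       = (singular_subdivision (p - Suc 0) ^^ N) (chain_boundary p c)"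
  by (induction N)
    (simp_all add: chain_boundary_singular_subdivision[OF singular_chain_iterated_subdivision[OF assms]])

lemma naturality_iterated_subdivision:
  assumes "singular_chain p X c"
  shows "(singular_subdivision p ^^ N) (chain_map p g c) = chain_map p g ((singular_subdivision p ^^ N) c)"
  by (induction N)
    (simp_all add: naturality_singular_subdivision[OF singular_chain_iterated_subdivision[OF assms]])

lemma iterated_subdivision_add:
  "(singular_subdivision p ^^ N) (a + b) = (singular_subdivision p ^^ N) a + (singular_subdivision p ^^ N) b"
  by (induction N) (simp_all add: singular_subdivision_add)

lemma iterated_subdivision_cmul:
  "(singular_subdivision p ^^ N) (frag_cmul k a) = frag_cmul k ((singular_subdivision p ^^ N) a)"
  by (induction N) (simp_all add: singular_subdivision_def frag_extend_cmul)

text \<open>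
  If every member of the cover were free of complementary pairs, so would be the vertex labels of all
  simplices of a sufficiently fine subdivision of the hemispheres. Then the number of alternating
  simplices in the hemisphere of dimension \<open>p\<close>, with either starting sign, is odd for every
  \<open>p \<le> n\<close>. It is 1 for a point. The number in dimension \<open>p + 1\<close> is, modulo 2 and by the coboundary
  formula, the number of those with negative starting sign in the boundary, that is, in the hemisphere of dimension
  \<open>p\<close> and its antipode. The antipodal map reverses the starting sign, so this is the number in
  dimension \<open>p\<close>. But an alternating \<open>n\<close>-simplex needs \<open>n + 1\<close> different indices.

  Antipodality of the labels is only required on the sphere of dimension \<open>n - 1\<close>, which bounds the
  hemisphere of dimension \<open>n\<close>.
\<close>

theorem tucker_cover:
  assumes antipode: "\<And>x. x \<in> octahedral_sphere n \<Longrightarrow> x n = 0 \<Longrightarrow> l (neg x) = flip (l x)"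
    and labels: "\<And>x. x \<in> octahedral_sphere n \<Longrightarrow> l x div 2 < n"
    and opn: "\<And>U. U \<in> \<C> \<Longrightarrow> openin (powertop_real UNIV) U" and cover: "\<Union>\<C> = UNIV"
  shows "\<exists>U\<in>\<C>. \<not> complement_free (l ` U)"
proof (rule ccontr)
  assume "\<not> (\<exists>U\<in>\<C>. \<not> complement_free (l ` U))"
  then have free: "complement_free (l ` U)" if "U \<in> \<C>" for U
    using that by blast
  have "\<exists>N. \<forall>m f. N \<le> m \<longrightarrow> f \<in> Poly_Mapping.keys ((singular_subdivision p ^^ m) (hemisphere p))
         \<longrightarrow> (\<exists>V\<in>\<C>. f \<in> standard_simplex p \<rightarrow> V)" for p
  proof -
    have "singular_chain p (powertop_real UNIV) (hemisphere p)"
      using singular_chain_hemisphere[of p] by (simp add: singular_chain_subtopology)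
    then show ?thesis
      using sufficient_iterated_singular_subdivision_exists[of \<C> "powertop_real UNIV" p "hemisphere p"]
        opn cover by (metis subset_UNIV)
  qed
  then obtain N where N: "\<And>p m f. N p \<le> m
      \<Longrightarrow> f \<in> Poly_Mapping.keys ((singular_subdivision p ^^ m) (hemisphere p))
      \<Longrightarrow> \<exists>V\<in>\<C>. f \<in> standard_simplex p \<rightarrow> V"
    by metis
  \<comment> \<open>The same number of subdivisions is used in all dimensions, to keep the boundary relation.\<close>
  define M where "M = Max (N ` {..n})"
  define c where "c p = (singular_subdivision p ^^ M) (hemisphere p)" for p
  have small: "complement_free (l ` f ` standard_simplex p)"
    if p: "p \<le> n" and f: "f \<in> Poly_Mapping.keys (c p)" for p f
  proof -
    have "N p \<le> M"
      using p by (simp add: M_def)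
    then obtain V where "V \<in> \<C>" "f ` standard_simplex p \<subseteq> V"
      using N f unfolding c_def by (metis image_subset_iff_funcset)
    then show ?thesis
      using complement_free_subset[OF free] by (metis image_mono)
  qed
  have sphere: "f ` standard_simplex p \<subseteq> octahedral_sphere p" if "f \<in> Poly_Mapping.keys (c p)" for p f
    using singular_chain_iterated_subdivision[OF singular_chain_hemisphere, of p M] that
    by (simp add: c_def singular_chain_subtopology)
  have boundary: "chain_boundary (Suc p) (c (Suc p)) = c p + frag_cmul ((-1) ^ Suc p) (chain_map p neg (c p))" for p
    unfolding c_def chain_boundary_iterated_subdivision[OF singular_chain_hemisphere] chain_boundary_hemisphere
    by (simp add: iterated_subdivision_add iterated_subdivision_cmul
        naturality_iterated_subdivision[OF singular_chain_hemisphere] del: power_Suc)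
  define a where "a p = pairing (alternation True l p) (c p) + pairing (alternation False l p) (c p)" for p
  have "odd (a p)" if "p \<le> n" for p
    using that
  proof (induction p)
    case 0
    have "c 0 = hemisphere 0"
      unfolding c_def by (induction M) (simp_all only: funpow.simps id_apply comp_apply
          singular_subdivision_zero[OF singular_chain_hemisphere])
    then show ?case
      by (simp add: a_def alternation_def vertex_labels_def)
  next
    case (Suc p)
    have "pairing (alternation True l p) (chain_map p neg (c p)) = pairing (alternation False l p) (c p)"
      unfolding pairing_chain_map
    proof (rule pairing_cong)
      fix f assume f: "f \<in> Poly_Mapping.keys (c p)"
      have "l (neg x) = flip (l x)" if "x \<in> octahedral_sphere p" for x
        using antipode that Suc.prems octahedral_sphere_mono[of p n]
        by (auto simp: octahedral_sphere_def subset_iff)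
      then show "(alternation True l p \<circ> simplex_map p neg) f = alternation False l p f"
        using alternation_antipode[of "octahedral_sphere p" l f p True] sphere[OF f] small[OF _ f] Suc.prems
        by simp
    qed
    then have "pairing (alternation True l p) (chain_boundary (Suc p) (c (Suc p)))
        = pairing (alternation True l p) (c p) + (-1) ^ Suc p * pairing (alternation False l p) (c p)"
      by (simp add: boundary pairing_add pairing_cmul del: power_Suc)
    then have "odd (pairing (alternation True l p) (chain_boundary (Suc p) (c (Suc p))))"
      using Suc by (simp add: a_def)
    then show ?case
      using alternation_coboundary[of True l p "c (Suc p)"] by (simp add: a_def) blast
  qed
  moreover have "pairing (alternation b l n) (c n) = 0" for b
  proof (rule pairing_eq_0)
    fix f assume f: "f \<in> Poly_Mapping.keys (c n)"
    let ?as = "sort (vertex_labels l n f)"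
    have as: "set ?as \<subseteq> l ` f ` standard_simplex n"
      using set_vertex_labels by simp
    have "\<not> alternating b ?as"
    proof
      assume "alternating b ?as"
      then have "length ?as \<le> n"
      proof (rule alternating_length_le[rotated])
        show "complement_free (set ?as)"
          using small[OF order_refl f] as by (rule complement_free_subset)
        show "a div 2 < n" if "a \<in> set ?as" for a
          using that as labels sphere[OF f] by blast
      qed simp
      then show False
        by simp
    qed
    then show "alternation b l n f = 0"
      by (simp add: alternation_def)
  qed
  ultimately show False
    by (force simp: a_def)
qed

section \<open>The Borsuk-Ulam theorem on a ball\<close>


text \<open>
  Label a point by the index of a coordinate of \<open>h\<close> of maximal modulus, together with its sign. If
  \<open>h\<close> has no zero, this coordinate is bounded away from 0 locally, so nearby points never have
  complementary labels, whereas Tucker's lemma provides such points in some member of every open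
  cover. The hemisphere of dimension \<open>n\<close> enters through its projection to the first \<open>n\<close> coordinates.
\<close>

theorem borsuk_ulam_ball:
  fixes h :: "'a::euclidean_space \<Rightarrow> 'a"
  assumes r: "0 < r" and cont: "continuous_on (cball 0 r) h"
    and odd_h: "\<And>x. norm x = r \<Longrightarrow> h (- x) = - h x"
  shows "\<exists>x\<in>cball 0 r. h x = 0"
proof (rule ccontr)
  assume "\<not> (\<exists>x\<in>cball 0 r. h x = 0)"
  then have nonzero: "h x \<noteq> 0" if "norm x \<le> r" for x
    using that by auto
  define n where "n = DIM('a)"
  have n: "0 < n"
    by (simp add: n_def)
  obtain b where "bij_betw b {0..<n} (Basis :: 'a set)"
    using ex_bij_betw_nat_finite[OF finite_Basis] unfolding n_def by blast
  then have b: "inj_on b {..<n}" "b ` {..<n} = (Basis :: 'a set)"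
    by (auto simp: bij_betw_def atLeast0LessThan)
  have inner_b: "b i \<bullet> b j = (if i = j then 1 else 0)" if "i < n" "j < n" for i j
  proof -
    have "b i \<in> Basis" "b j \<in> Basis"
      using that b(2) by auto
    moreover have "b i = b j \<longleftrightarrow> i = j"
      using that b(1) by (simp add: inj_on_eq_iff)
    ultimately show ?thesis
      by (simp add: inner_Basis)
  qed

  \<comment> \<open>The same index is chosen for \<open>y\<close> and \<open>- y\<close>, as only absolute values are used.\<close>
  define idx where "idx y = (SOME i. i < n \<and> (\<forall>j<n. \<bar>y \<bullet> b j\<bar> \<le> \<bar>y \<bullet> b i\<bar>))" for y
  have idx: "idx y < n \<and> (\<forall>j<n. \<bar>y \<bullet> b j\<bar> \<le> \<bar>y \<bullet> b (idx y)\<bar>)" for y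
  proof -
    let ?V = "(\<lambda>i. \<bar>y \<bullet> b i\<bar>) ` {..<n}"
    have "Max ?V \<in> ?V"
      using n by (intro Max_in) auto
    then obtain i where "i < n" "Max ?V = \<bar>y \<bullet> b i\<bar>"
      by auto
    then have "\<exists>i. i < n \<and> (\<forall>j<n. \<bar>y \<bullet> b j\<bar> \<le> \<bar>y \<bullet> b i\<bar>)"
      by (metis Max_ge finite_imageI finite_lessThan image_eqI lessThan_iff)
    then show ?thesis
      unfolding idx_def by (rule someI_ex)
  qed
  have idx_minus: "idx (- y) = idx y" for y
    by (simp add: idx_def)
  have idx_pos: "0 < \<bar>y \<bullet> b (idx y)\<bar>" if y: "y \<noteq> 0" for y
  proof -
    obtain u where "u \<in> Basis" "y \<bullet> u \<noteq> 0"
      using y euclidean_all_zero_iff[of y] by blast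
    then obtain j where "j < n" "y \<bullet> b j \<noteq> 0"
      using b(2) by (metis imageE lessThan_iff)
    then have "0 < \<bar>y \<bullet> b j\<bar>"
      by simp
    also have "\<dots> \<le> \<bar>y \<bullet> b (idx y)\<bar>"
      using idx[of y] \<open>j < n\<close> by blast
    finally show ?thesis .
  qed
  define label where "label y = 2 * idx y + of_bool (y \<bullet> b (idx y) < 0)" for y
  have label_div: "label y div 2 = idx y" for y
    by (simp add: label_def)
  have label_minus: "label (- y) = flip (label y)" if "y \<noteq> 0" for y
    using idx_pos[OF that] by (auto simp: label_def flip_def idx_minus)
  have label_local: "complement_free (label ` ball y (\<bar>y \<bullet> b (idx y)\<bar> / 2))" if y: "y \<noteq> 0" for y
  proof -
    let ?M = "\<bar>y \<bullet> b (idx y)\<bar>"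
    have large: "?M / 2 < \<bar>z \<bullet> b (idx z)\<bar>" if "z \<in> ball y (?M / 2)" for z
    proof -
      have "\<bar>(y - z) \<bullet> b (idx y)\<bar> \<le> norm (y - z)"
        using b(2) idx[of y] Basis_le_norm by blast
      also have "\<dots> < ?M / 2"
        using that by (simp add: dist_norm)
      finally have "?M / 2 < \<bar>z \<bullet> b (idx y)\<bar>"
        unfolding inner_diff_left by linarith
      then show ?thesis
        using idx[of y] idx[of z] by (meson less_le_trans)
    qed
    have no_pair: "label w \<noteq> flip (label z)" if z: "z \<in> ball y (?M / 2)" and w: "w \<in> ball y (?M / 2)" for z w
    proof
      assume eq: "label w = flip (label z)"
      then have "label w div 2 = label z div 2" and par: "odd (label w) \<noteq> odd (label z)"
        by (auto simp: flip_def elim!: oddE)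
      then have i: "idx w = idx z"
        by (simp add: label_div)
      have "(w \<bullet> b (idx z) < 0) \<noteq> (z \<bullet> b (idx z) < 0)"
        using par i by (auto simp: label_def)
      then have "?M < \<bar>(w - z) \<bullet> b (idx z)\<bar>"
        using large[OF z] large[OF w] i by (auto simp: inner_diff_left)
      also have "\<dots> \<le> norm (w - z)"
        using b(2) idx[of z] Basis_le_norm by blast
      also have "\<dots> < ?M"
        using z w dist_triangle_half_r[of y w ?M z] by (simp add: dist_norm)
      finally show False .
    qed
    show ?thesis
      unfolding complement_free_def
    proof (intro ballI notI; elim imageE)
      fix a z w
      assume "a = label z" "z \<in> ball y (?M / 2)" "flip a = label w" "w \<in> ball y (?M / 2)"
      then show False
        using no_pair[of z w] by simp
    qed
  qed

  \<comment> \<open>The factor \<open>r * n\<close> in \<open>P\<close> puts the image of the \<open>l\<^sub>1\<close>-sphere outside the open ball of radius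
    \<open>r\<close>, and the radial retraction \<open>\<rho>\<close> then maps it to the sphere where \<open>h\<close> is odd.\<close>
  define \<rho> where "\<rho> y = (r / max r (norm y)) *\<^sub>R y" for y :: 'a
  define P where "P x = (\<Sum>i<n. (r * n * x i) *\<^sub>R b i)" for x :: "nat \<Rightarrow> real"
  define g where "g x = h (\<rho> (P x))" for x
  have \<rho>_ball: "norm (\<rho> y) \<le> r" for y
    using r by (simp add: \<rho>_def field_simps)
  have \<rho>_sphere: "norm (\<rho> y) = r" if "r \<le> norm y" for y
  proof -
    have "0 < norm y"
      using r that by linarith
    then show ?thesis
      using r that by (simp add: \<rho>_def max_absorb2)
  qed
  have g_nonzero: "g x \<noteq> 0" for x
    using nonzero \<rho>_ball by (simp add: g_def)
  have "continuous_on UNIV (\<lambda>x. \<rho> (P x))"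
    unfolding \<rho>_def P_def using r
    by (intro continuous_intros continuous_on_product_coordinates) auto
  then have "continuous_on UNIV g"
    unfolding g_def using \<rho>_ball by (intro continuous_on_compose2[OF cont]) auto
  then have g_map: "continuous_map (powertop_real UNIV) euclidean g"
    by (simp add: euclidean_product_topology)
  have g_odd: "g (neg x) = - g x" if x: "x \<in> octahedral_sphere n" "x n = 0" for x
  proof -
    have sum1: "(\<Sum>i<n. \<bar>x i\<bar>) = 1"
      using x by (simp add: octahedral_sphere_def flip: lessThan_Suc_atMost)
    have "\<exists>i<n. 1 / n \<le> \<bar>x i\<bar>"
    proof (rule ccontr)
      assume "\<not> (\<exists>i<n. 1 / n \<le> \<bar>x i\<bar>)"
      then have "(\<Sum>i<n. \<bar>x i\<bar>) < (\<Sum>i<n. 1 / n)"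
        using n by (intro sum_strict_mono) (auto simp: not_le)
      then show False
        using sum1 n by simp
    qed
    then obtain i where i: "i < n" "1 / n \<le> \<bar>x i\<bar>"
      by blast
    have "P x \<bullet> b i = (\<Sum>j<n. r * n * x j * (if j = i then 1 else 0))"
      unfolding P_def inner_sum_left inner_scaleR_left using i inner_b by (intro sum.cong) auto
    also have "\<dots> = r * n * x i"
      using i by (simp add: if_distrib cong: if_cong)
    finally have "r \<le> \<bar>P x \<bullet> b i\<bar>"
      using r n i by (simp add: abs_mult field_simps)
    then have "r \<le> norm (P x)"
      using b(2) i Basis_le_norm[of "b i" "P x"] by fastforce
    moreover have "P (neg x) = - P x"
      by (simp add: P_def sum_negf)
    moreover have "\<rho> (- y) = - \<rho> y" for y
      by (simp add: \<rho>_def)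
    ultimately show ?thesis
      using odd_h \<rho>_sphere by (simp add: g_def)
  qed

  define \<C> where "\<C> = range (\<lambda>x. g -` ball (g x) (\<bar>g x \<bullet> b (idx (g x))\<bar> / 2))"
  have "\<exists>U\<in>\<C>. \<not> complement_free ((label \<circ> g) ` U)"
  proof (rule tucker_cover[of n])
    show "(label \<circ> g) (neg x) = flip ((label \<circ> g) x)" if "x \<in> octahedral_sphere n" "x n = 0" for x
      using g_odd[OF that] label_minus[OF g_nonzero] by simp
    show "(label \<circ> g) x div 2 < n" for x
      using idx by (simp add: label_div)
    have "openin (powertop_real UNIV) (g -` ball y \<epsilon>)" for y \<epsilon>
      using openin_continuous_map_preimage[OF g_map, of "ball y \<epsilon>"] by (simp add: vimage_def del: mem_ball)
    then show "openin (powertop_real UNIV) U" if "U \<in> \<C>" for U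
      using that unfolding \<C>_def by blast
    have "x \<in> g -` ball (g x) (\<bar>g x \<bullet> b (idx (g x))\<bar> / 2)" for x
      using idx_pos[OF g_nonzero, of x] by simp
    then show "\<Union>\<C> = UNIV"
      unfolding \<C>_def by blast
  qed
  then obtain x where "\<not> complement_free ((label \<circ> g) ` (g -` ball (g x) (\<bar>g x \<bullet> b (idx (g x))\<bar> / 2)))"
    unfolding \<C>_def by blast
  moreover have "(label \<circ> g) ` (g -` B) \<subseteq> label ` B" for B
    by auto
  ultimately show False
    using complement_free_subset[OF label_local[OF g_nonzero]] by blast
qed

section \<open>Coercivity of EHP tensors and the complementarity path\<close>


lemma finite_index_lists: "finite {is :: 'n::finite list. length is = m}"
  using finite_lists_length_eq[of "UNIV :: 'n set" m] by simp

lemma tensor_apply_scaleR: "tensor_apply m A (c *\<^sub>R x) = c ^ (m - 1) *\<^sub>R tensor_apply m A x"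
proof -
  have prod: "prod_list (map (\<lambda>j. (c *\<^sub>R x) $ j) is) = c ^ length is * prod_list (map (\<lambda>j. x $ j) is)" for "is"
    by (induction "is") (simp_all add: mult_ac)
  have eq: "A (i # is) * prod_list (map (\<lambda>j. (c *\<^sub>R x) $ j) is)
      = c ^ (m - 1) * (A (i # is) * prod_list (map (\<lambda>j. x $ j) is))" if "length is = m - 1" for i "is"
    unfolding prod by (simp add: that mult_ac)
  have "(\<Sum>is | length is = m - 1. A (i # is) * prod_list (map (\<lambda>j. (c *\<^sub>R x) $ j) is))
      = c ^ (m - 1) * (\<Sum>is | length is = m - 1. A (i # is) * prod_list (map (\<lambda>j. x $ j) is))" for i
    unfolding sum_distrib_left by (intro sum.cong refl eq) simp
  then show ?thesis
    unfolding tensor_apply_def vec_eq_iff vector_scaleR_component real_scaleR_def vec_lambda_beta by blast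
qed

lemma continuous_on_tensor_apply [continuous_intros]:
  assumes "continuous_on S f"
  shows "continuous_on S (\<lambda>x. tensor_apply m A (f x))"
proof -
  have "continuous_on S (\<lambda>x. prod_list (map (\<lambda>j. f x $ j) is))" for "is"
    by (induction "is") (auto intro!: continuous_intros assms)
  then show ?thesis
    unfolding tensor_apply_def by (intro continuous_on_vec_lambda continuous_intros)
qed

text \<open>
  Both notions only involve \<open>x\<^sub>0, \<dots>, x\<^sub>k\<close>, but tuples are taken here as total functions, so that the
  topology and the continuity rules of the type \<open>nat \<Rightarrow> real ^ 'n\<close> apply.
\<close>

definition residual :: "nat \<Rightarrow> nat \<Rightarrow> (nat \<Rightarrow> 'n::finite list \<Rightarrow> real) \<Rightarrow> (nat \<Rightarrow> real ^ 'n) \<Rightarrow> real ^ 'n" where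
  "residual m k A x = tensor_apply m (A 0) (x 0) - (\<Sum>j = 1..k. tensor_apply m (A j) (x j))"

definition sign_opposed :: "nat \<Rightarrow> (nat \<Rightarrow> real ^ 'n::finite) \<Rightarrow> bool" where
  "sign_opposed k x \<longleftrightarrow> (\<forall>j\<in>{1..k}. \<forall>c. x 0 $ c * x j $ c \<le> 0)"

lemma residual_scaleR: "residual m k A (\<lambda>j. c *\<^sub>R x j) = c ^ (m - 1) *\<^sub>R residual m k A x"
  by (simp add: residual_def tensor_apply_scaleR scaleR_sum_right scaleR_diff_right)

lemma residual_cong: "(\<And>j. j \<le> k \<Longrightarrow> x j = y j) \<Longrightarrow> residual m k A x = residual m k A y"
  by (simp add: residual_def)

lemma continuous_on_residual:
  assumes "\<And>j. j \<le> k \<Longrightarrow> continuous_on S (\<lambda>x. f x j)"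
  shows "continuous_on S (\<lambda>x. residual m k A (f x))"
  unfolding residual_def using assms by (intro continuous_intros) auto

text \<open>
  The EHP property says that the residual does not vanish on the sign-opposed tuples of size 1. They
  form a compact set, so its norm has a positive minimum there, and homogeneity extends the estimate
  to tuples of any size.
\<close>

lemma EHP_tensor_coercive:
  fixes A :: "nat \<Rightarrow> 'n::finite list \<Rightarrow> real"
  assumes "EHP_tensor m k A" "m \<ge> 2"
  obtains \<epsilon> where "0 < \<epsilon>"
    "\<And>x. sign_opposed k x \<Longrightarrow> \<epsilon> * (\<Sum>j\<le>k. norm (x j)) ^ (m - 1) \<le> norm (residual m k A x)"
proof -
  \<comment> \<open>Entries beyond \<open>k\<close> are set to 0, which makes the set of tuples compact.\<close>
  define B where "B = (\<Pi>\<^sub>E j\<in>UNIV. if j \<le> k then cball 0 1 else {0 :: real ^ 'n})"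
  define K where "K = B \<inter> ({x. (\<Sum>j\<le>k. norm (x j)) = 1} \<inter> {x. sign_opposed k x})"
  have "compactin (product_topology (\<lambda>_::nat. euclidean) UNIV) B"
    unfolding B_def by (subst compactin_PiE) simp
  then have "compact B"
    by (simp add: euclidean_product_topology)
  moreover have "closed {x :: nat \<Rightarrow> real ^ 'n. (\<Sum>j\<le>k. norm (x j)) = 1}"
    by (intro closed_Collect_eq continuous_intros continuous_on_product_coordinates)
  moreover have "closed {x :: nat \<Rightarrow> real ^ 'n. sign_opposed k x}"
    unfolding sign_opposed_def Ball_def
    by (intro closed_Collect_all closed_Collect_imp open_Collect_const closed_Collect_le
        continuous_intros continuous_on_product_coordinates)
  ultimately have "compact K"
    unfolding K_def by (intro compact_Int_closed closed_Int)
  have nonzero: "residual m k A x \<noteq> 0" if "x \<in> K" for x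
  proof
    assume res: "residual m k A x = 0"
    let ?x = "restrict x {..k}"
    have "residual m k A ?x = 0"
      using res by (subst residual_cong[of k _ x]) auto
    moreover have "\<forall>i\<in>{1..k}. ?x 0 * ?x i \<le> 0"
      using that by (auto simp: K_def sign_opposed_def less_eq_vec_def)
    ultimately have "\<forall>i\<in>{0..k}. ?x i = 0"
      using assms(1)[unfolded EHP_tensor_def, rule_format, of ?x] by (simp add: residual_def)
    then have "(\<Sum>j\<le>k. norm (x j)) = 0"
      by simp
    then show False
      using that by (simp add: K_def)
  qed
  obtain \<epsilon> where \<epsilon>: "0 < \<epsilon>" "\<And>x. x \<in> K \<Longrightarrow> \<epsilon> \<le> norm (residual m k A x)"
  proof (cases "K = {}")
    case False
    have "continuous_on K (\<lambda>x. norm (residual m k A x))"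
      by (intro continuous_on_norm continuous_on_residual)
        (rule continuous_on_subset[OF continuous_on_product_coordinates], simp)
    then obtain x where "x \<in> K" "\<And>y. y \<in> K \<Longrightarrow> norm (residual m k A x) \<le> norm (residual m k A y)"
      using continuous_attains_inf[OF \<open>compact K\<close> False] by blast
    then show ?thesis
      using that[of "norm (residual m k A x)"] nonzero by simp
  qed (use that[of 1] in simp)
  show ?thesis
  proof (rule that[OF \<epsilon>(1)])
    fix x :: "nat \<Rightarrow> real ^ 'n" assume opp: "sign_opposed k x"
    define s where "s = (\<Sum>j\<le>k. norm (x j))"
    have norm_le: "norm (x j) \<le> s" if "j \<le> k" for j
      using that unfolding s_def by (intro member_le_sum) auto
    have "\<epsilon> * s ^ (m - 1) \<le> norm (residual m k A x)"
    proof (cases "s = 0")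
      case False
      then have s: "0 < s"
        unfolding s_def by (simp add: less_le sum_nonneg)
      define y where "y j = (if j \<le> k then (1 / s) *\<^sub>R x j else 0)" for j
      have "(\<Sum>j\<le>k. norm (y j)) = 1"
        using s by (simp add: y_def s_def flip: sum_divide_distrib)
      moreover have "sign_opposed k y"
        using opp s by (auto simp: sign_opposed_def y_def divide_le_0_iff)
      moreover have "y \<in> B"
        using norm_le s by (auto simp: B_def y_def)
      ultimately have "\<epsilon> \<le> norm (residual m k A y)"
        using \<epsilon>(2) by (simp add: K_def)
      then have "\<epsilon> * s ^ (m - 1) \<le> norm (s ^ (m - 1) *\<^sub>R residual m k A y)"
        using s by (simp add: mult.commute)
      also have "s ^ (m - 1) *\<^sub>R residual m k A y = residual m k A x"
        unfolding residual_scaleR[symmetric] using s by (intro residual_cong) (simp add: y_def)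
      finally show ?thesis .
    qed (use assms(2) in \<open>simp add: power_0_left\<close>)
    then show "\<epsilon> * (\<Sum>j\<le>k. norm (x j)) ^ (m - 1) \<le> norm (residual m k A x)"
      by (simp add: s_def)
  qed
qed

text \<open>
  The entry \<open>x\<^sub>j\<close> at time \<open>t\<close> on the polygonal path of one coordinate. For \<open>t \<le> 0\<close> only
  \<open>x\<^sub>0 = -t\<close> may be nonzero; from time \<open>d\<^sub>1 + \<dots> + d\<^bsub>j-1\<^esub>\<close> on, \<open>x\<^sub>j\<close> grows with unit speed, up to
  \<open>d\<^sub>j\<close> if \<open>j < k\<close> and without bound if \<open>j = k\<close>.
\<close>

definition leg :: "nat \<Rightarrow> (nat \<Rightarrow> real) \<Rightarrow> nat \<Rightarrow> real \<Rightarrow> real" where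
  "leg k d j t =
    (if j = 0 then max 0 (- t)
     else if j < k then max 0 (min (t - (\<Sum>i = 1..j - 1. d i)) (d j))
     else max 0 (t - (\<Sum>i = 1..j - 1. d i)))"

lemma leg_nonneg: "0 \<le> leg k d j t"
  by (simp add: leg_def)

lemma leg_first_complementary: "k \<ge> 1 \<Longrightarrow> min (leg k d 0 t) (leg k d 1 t) = 0"
  by (auto simp: leg_def)

lemma leg_complementary:
  assumes "1 \<le> j" "j < k" "\<forall>j\<in>{1..k-1}. 0 < d j"
  shows "min (d j - leg k d j t) (leg k d (j + 1) t) = 0"
proof -
  define u where "u = t - (\<Sum>i = 1..j - 1. d i)"
  have u: "t - (\<Sum>i = 1..j. d i) = u - d j"
    using assms(1) by (cases j) (simp_all add: u_def)
  have leg: "leg k d j t = max 0 (min u (d j))"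
    using assms(1,2) by (simp add: leg_def u_def)
  have "0 < d j"
    using assms by auto
  show ?thesis
  proof (cases "u \<le> d j")
    case True
    then have "leg k d (j + 1) t = 0"
      using u by (simp add: leg_def)
    moreover have "leg k d j t \<le> d j"
      using \<open>0 < d j\<close> by (simp add: leg)
    ultimately show ?thesis
      by simp
  next
    case False
    then have "leg k d j t = d j"
      using \<open>0 < d j\<close> by (simp add: leg)
    then show ?thesis
      using leg_nonneg[of k d "j + 1" t] by simp
  qed
qed

lemma leg_eq_0:
  assumes "1 \<le> j" "j \<le> k" "\<forall>j\<in>{1..k-1}. 0 < d j" "t \<le> 0"
  shows "leg k d j t = 0"
proof -
  have "0 \<le> (\<Sum>i = 1..j - 1. d i)"
    using assms by (intro sum_nonneg) (auto intro!: less_imp_le)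
  then show ?thesis
    using assms by (auto simp: leg_def)
qed

text \<open>
  The parameter can be recovered from the path, which therefore leaves every bounded set.
\<close>

lemma sum_leg:
  assumes "k \<ge> 1" "\<forall>j\<in>{1..k-1}. 0 < d j"
  shows "(\<Sum>j = 1..k. leg k d j t) - leg k d 0 t = t"
proof -
  have partial: "(\<Sum>j = 1..l. leg k d j t) = max 0 (min t (\<Sum>i = 1..l. d i))
      \<and> 0 \<le> (\<Sum>i = 1..l. d i)" if "l < k" for l
    using that
  proof (induction l)
    case (Suc l)
    then have "0 < d (Suc l)"
      using assms(2) by auto
    then show ?case
      using Suc by (auto simp: leg_def)
  qed simp
  obtain l where l: "k = Suc l"
    using assms(1) by (cases k) auto
  then show ?thesis
    using partial[of l] by (auto simp: leg_def)
qed

text \<open>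
  If \<open>x\<^sub>0 > 0\<close>, then \<open>x\<^sub>1 = 0 < d\<^sub>1\<close>, which forces \<open>x\<^sub>2 = 0\<close>, and so on up to \<open>x\<^sub>k = 0\<close>.
\<close>

lemma complementary_imp_opposed:
  fixes x d :: "nat \<Rightarrow> real"
  assumes "min (x 0) (x 1) = 0" "\<And>j. j \<in> {1..k - 1} \<Longrightarrow> min (d j - x j) (x (j + 1)) = 0"
    and "\<forall>j\<in>{1..k-1}. 0 < d j" "1 \<le> j" "j \<le> k"
  shows "x 0 * x j \<le> 0"
proof (cases "x 0 = 0")
  case False
  have "x j = 0"
    using assms(4,5)
  proof (induction j rule: dec_induct)
    case base
    then show ?case
      using assms(1) False by (auto simp: min_def split: if_splits)
  next
    case (step i)
    then have i: "i \<in> {1..k - 1}" "x i = 0"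
      by auto
    with assms(2)[OF i(1)] bspec[OF assms(3) i(1)] show ?case
      by (auto simp: min_def split: if_splits)
  qed
  then show ?thesis
    by simp
qed simp

section \<open>Existence and compactness of solutions\<close>


text \<open>
  The form of coercivity that both parts of the theorem use: sign-opposed tuples with bounded residual
  are bounded.
\<close>

lemma EHP_tensor_bounded:
  fixes A :: "nat \<Rightarrow> 'n::finite list \<Rightarrow> real"
  assumes "EHP_tensor m k A" "m \<ge> 2"
  obtains R where "0 < R"
    "\<And>x. sign_opposed k x \<Longrightarrow> norm (residual m k A x) \<le> C \<Longrightarrow> (\<Sum>j\<le>k. norm (x j)) < R"
proof -
  obtain \<epsilon> where \<epsilon>: "0 < \<epsilon>"
    "\<And>x. sign_opposed k x \<Longrightarrow> \<epsilon> * (\<Sum>j\<le>k. norm (x j)) ^ (m - 1) \<le> norm (residual m k A x)"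
    using EHP_tensor_coercive[OF assms] by blast
  define R where "R = 1 + \<bar>C\<bar> / \<epsilon>"
  have R: "1 \<le> R"
    using \<epsilon>(1) by (simp add: R_def)
  show ?thesis
  proof (rule that)
    show "0 < R"
      using R by simp
    fix x :: "nat \<Rightarrow> real ^ 'n"
    assume x: "sign_opposed k x" "norm (residual m k A x) \<le> C"
    show "(\<Sum>j\<le>k. norm (x j)) < R"
    proof (rule ccontr)
      assume "\<not> (\<Sum>j\<le>k. norm (x j)) < R"
      then have "R ^ (m - 1) \<le> (\<Sum>j\<le>k. norm (x j)) ^ (m - 1)"
        using R by (intro power_mono) auto
      moreover have "R \<le> R ^ (m - 1)"
        using R assms(2) by (intro self_le_power) auto
      ultimately have "\<epsilon> * R \<le> \<epsilon> * (\<Sum>j\<le>k. norm (x j)) ^ (m - 1)"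
        using \<epsilon>(1) by simp
      also have "\<dots> \<le> C"
        using \<epsilon>(2)[OF x(1)] x(2) by simp
      finally show False
        using \<epsilon>(1) by (simp add: R_def distrib_left)
    qed
  qed
qed

definition leg_vec :: "nat \<Rightarrow> (nat \<Rightarrow> real ^ 'n::finite) \<Rightarrow> real ^ 'n \<Rightarrow> nat \<Rightarrow> real ^ 'n" where
  "leg_vec k d t j = (\<chi> c. leg k (\<lambda>i. d i $ c) j (t $ c))"

lemma continuous_on_leg_vec: "continuous_on S (\<lambda>t. leg_vec k d t j)"
proof -
  have "continuous_on UNIV (leg k e j)" for e
    unfolding leg_def by (cases "j = 0"; cases "j < k") (auto intro!: continuous_intros)
  then have "continuous_on S (\<lambda>t. leg k e j (t $ c))" for e and c :: 'a
    by (rule continuous_on_compose2) (auto intro!: continuous_intros)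
  then show ?thesis
    unfolding leg_vec_def by (intro continuous_on_vec_lambda)
qed

text \<open>
  The linear deformation of the path point \<open>leg_vec k d t\<close>, at \<open>s = 0\<close>, into the tuple
  \<open>(-t, 0, \<dots>, 0)\<close>, at \<open>s = 1\<close>.
\<close>

definition tilt :: "nat \<Rightarrow> (nat \<Rightarrow> real ^ 'n::finite) \<Rightarrow> real \<Rightarrow> real ^ 'n \<Rightarrow> nat \<Rightarrow> real ^ 'n" where
  "tilt k d s t j = (1 - s) *\<^sub>R leg_vec k d t j - (if j = 0 then s *\<^sub>R t else 0)"

lemma continuous_on_tilt:
  assumes "continuous_on S \<sigma>"
  shows "continuous_on S (\<lambda>t. tilt k d (\<sigma> t) t j)"
  unfolding tilt_def
  by (cases "j = 0") (auto intro!: continuous_intros continuous_on_leg_vec assms)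

text \<open>
  Both ends of the deformation, and so all its stages, satisfy the same linear identity. It bounds the
  parameter by the size of the tuple.
\<close>

lemma tilt_sum:
  assumes "k \<ge> 1" "\<forall>j\<in>{1..k - 1}. d j \<in> pos_vecs"
  shows "(\<Sum>j = 1..k. tilt k d s t j) - tilt k d s t 0 = t"
proof -
  have "(\<Sum>j = 1..k. leg_vec k d t j) - leg_vec k d t 0 = t"
    using sum_leg[OF assms(1), of "\<lambda>i. d i $ _"] assms(2)
    by (simp add: vec_eq_iff leg_vec_def pos_vecs_def)
  moreover have "(\<Sum>j = 1..k. tilt k d s t j) - tilt k d s t 0
      = (1 - s) *\<^sub>R ((\<Sum>j = 1..k. leg_vec k d t j) - leg_vec k d t 0) + s *\<^sub>R t"
    by (simp add: tilt_def scaleR_diff_right flip: scaleR_sum_right)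
  ultimately show ?thesis
    by (simp flip: scaleR_add_left)
qed

lemma norm_le_tilt:
  assumes "k \<ge> 1" "\<forall>j\<in>{1..k - 1}. d j \<in> pos_vecs"
  shows "norm t \<le> (\<Sum>j\<le>k. norm (tilt k d s t j))"
proof -
  have "norm t \<le> norm (\<Sum>j = 1..k. tilt k d s t j) + norm (tilt k d s t 0)"
    using norm_triangle_ineq4[of "\<Sum>j = 1..k. tilt k d s t j" "tilt k d s t 0"] tilt_sum[OF assms]
    by simp
  also have "\<dots> \<le> (\<Sum>j = 1..k. norm (tilt k d s t j)) + norm (tilt k d s t 0)"
    using norm_sum by (intro add_right_mono)
  also have "\<dots> = (\<Sum>j\<le>k. norm (tilt k d s t j))"
    by (simp add: atMost_atLeast0 sum.atLeast_Suc_atMost)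
  finally show ?thesis .
qed

text \<open>
  For \<open>t \<le> 0\<close> all entries but the first stay 0. For \<open>t > 0\<close> the path has \<open>x\<^sub>0 = 0\<close>, and the
  deformation moves this entry below 0 while the others stay nonnegative.
\<close>

lemma sign_opposed_tilt:
  assumes "\<forall>j\<in>{1..k - 1}. d j \<in> pos_vecs" "0 \<le> s" "s \<le> 1"
  shows "sign_opposed k (tilt k d s t)"
  unfolding sign_opposed_def
proof (intro ballI allI)
  fix j c assume j: "j \<in> {1..k}"
  have d: "\<forall>j\<in>{1..k - 1}. 0 < d j $ c"
    using assms(1) by (simp add: pos_vecs_def)
  let ?x = "\<lambda>j. leg k (\<lambda>i. d i $ c) j (t $ c)"
  have tilt: "tilt k d s t 0 $ c = (1 - s) * ?x 0 - s * t $ c" "tilt k d s t j $ c = (1 - s) * ?x j"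
    using j by (auto simp: tilt_def leg_vec_def)
  show "tilt k d s t 0 $ c * tilt k d s t j $ c \<le> 0"
  proof (cases "t $ c \<le> 0")
    case True
    then have "?x j = 0"
      using leg_eq_0[of j k, OF _ _ d] j by simp
    then show ?thesis
      by (simp add: tilt)
  next
    case False
    then have "?x 0 = 0"
      by (simp add: leg_def)
    then show ?thesis
      using False assms(2,3) leg_nonneg unfolding tilt by (simp add: mult_nonneg_nonneg)
  qed
qed

lemma leg_vec_in_SOL:
  assumes "k \<ge> 1" "\<forall>j\<in>{1..k - 1}. d j \<in> pos_vecs" "residual m k A (leg_vec k d t) = q"
  shows "restrict (leg_vec k d t) {..k} \<in> SOL m k A d q"
proof -
  have "inf (leg_vec k d t 0) (leg_vec k d t 1) = 0"
    using leg_first_complementary[OF assms(1)] by (simp add: vec_eq_iff leg_vec_def inf_vec_def inf_min)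
  moreover have "inf (d j - leg_vec k d t j) (leg_vec k d t (j + 1)) = 0" if "j \<in> {1..k - 1}" for j
  proof -
    have "min (d j $ c - leg k (\<lambda>i. d i $ c) j (t $ c)) (leg k (\<lambda>i. d i $ c) (j + 1) (t $ c)) = 0" for c
      using that assms(1,2) by (intro leg_complementary) (auto simp: pos_vecs_def)
    then show ?thesis
      by (simp add: vec_eq_iff leg_vec_def inf_vec_def inf_min)
  qed
  moreover have "tensor_apply m (A 0) (leg_vec k d t 0) = q + (\<Sum>j = 1..k. tensor_apply m (A j) (leg_vec k d t j))"
    using assms(3) by (simp add: residual_def algebra_simps)
  ultimately show ?thesis
    using assms(1) by (auto simp: SOL_def)
qed

text \<open>
  The map \<open>h\<close> runs through the deformation in the shell \<open>R \<le> norm t \<le> 2 * R\<close>, while \<open>q\<close> is faded out.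
  On the outer sphere it is the residual of \<open>(-t, 0, \<dots>, 0)\<close>, an odd function of \<open>t\<close>. At a zero of
  \<open>h\<close> the residual is at most \<open>norm q\<close>, so the choice of \<open>R\<close> rules out that the zero lies in the shell.
\<close>

lemma SOL_nonempty:
  fixes A :: "nat \<Rightarrow> 'n::finite list \<Rightarrow> real"
  assumes m: "m \<ge> 2" "even m" and k: "k \<ge> 1" and EHP: "EHP_tensor m k A"
    and d: "\<forall>j\<in>{1..k - 1}. d j \<in> pos_vecs"
  shows "SOL m k A d q \<noteq> {}"
proof -
  obtain R where R: "0 < R"
    "\<And>x. sign_opposed k x \<Longrightarrow> norm (residual m k A x) \<le> norm q \<Longrightarrow> (\<Sum>j\<le>k. norm (x j)) < R"
    using EHP_tensor_bounded[OF EHP m(1)] by metis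
  define \<sigma> where "\<sigma> t = max 0 (min 1 (norm t / R - 1))" for t :: "real ^ 'n"
  define h where "h t = residual m k A (tilt k d (\<sigma> t) t) - (1 - \<sigma> t) *\<^sub>R q" for t
  have \<sigma>: "0 \<le> \<sigma> t" "\<sigma> t \<le> 1" for t
    by (auto simp: \<sigma>_def)
  have "continuous_on (cball 0 (2 * R)) \<sigma>"
    unfolding \<sigma>_def using R(1) by (intro continuous_intros) auto
  then have "continuous_on (cball 0 (2 * R)) h"
    unfolding h_def by (intro continuous_intros continuous_on_residual continuous_on_tilt)
  moreover have "h (- t) = - h t" if "norm t = 2 * R" for t
  proof -
    have h: "h u = residual m k A (\<lambda>j. if j = 0 then - u else 0)" if "norm u = 2 * R" for u
    proof -
      have "\<sigma> u = 1"
        using R(1) that by (simp add: \<sigma>_def)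
      moreover have "tilt k d 1 u = (\<lambda>j. if j = 0 then - u else 0)"
        by (simp add: tilt_def fun_eq_iff)
      ultimately show ?thesis
        by (simp add: h_def)
    qed
    have "h (- t) = residual m k A (\<lambda>j. (-1) *\<^sub>R (if j = 0 then - t else 0))"
      using h[of "- t"] that by (simp add: if_distrib cong: if_cong)
    also have "\<dots> = - h t"
      unfolding residual_scaleR using h[OF that] m by simp
    finally show ?thesis .
  qed
  ultimately obtain t where t: "h t = 0"
    using borsuk_ulam_ball[of "2 * R" h] R(1) by auto
  then have "norm (residual m k A (tilt k d (\<sigma> t) t)) = (1 - \<sigma> t) * norm q"
    using \<sigma>[of t] by (simp add: h_def)
  also have "\<dots> \<le> norm q"
    using \<sigma>[of t] by (simp add: mult_left_le_one_le)
  finally have "(\<Sum>j\<le>k. norm (tilt k d (\<sigma> t) t j)) < R"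
    using R(2) sign_opposed_tilt[OF d \<sigma>] by blast
  then have "norm t < R"
    using norm_le_tilt[OF k d, of t "\<sigma> t"] by linarith
  then have "norm t / R < 1"
    using R(1) by simp
  then have "\<sigma> t = 0"
    by (simp add: \<sigma>_def)
  moreover have "tilt k d 0 t = leg_vec k d t"
    by (simp add: tilt_def fun_eq_iff)
  ultimately have "residual m k A (leg_vec k d t) = q"
    using t by (simp add: h_def)
  then show ?thesis
    using leg_vec_in_SOL[OF k d] by blast
qed

lemma sign_opposed_SOL:
  assumes "k \<ge> 1" "\<forall>j\<in>{1..k - 1}. d j \<in> pos_vecs" "x \<in> SOL m k A d q"
  shows "sign_opposed k x"
  unfolding sign_opposed_def
proof (intro ballI allI)
  fix j c assume j: "j \<in> {1..k}"
  have "min (x 0 $ c) (x 1 $ c) = 0"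
    using assms(3) by (simp add: SOL_def vec_eq_iff inf_vec_def inf_min)
  moreover have "min (d j $ c - x j $ c) (x (j + 1) $ c) = 0" if "j \<in> {1..k - 1}" for j
    using assms(3) that by (simp add: SOL_def vec_eq_iff inf_vec_def inf_min)
  moreover have "\<forall>j\<in>{1..k - 1}. 0 < d j $ c"
    using assms(2) by (simp add: pos_vecs_def)
  ultimately show "x 0 $ c * x j $ c \<le> 0"
    using j complementary_imp_opposed[of "\<lambda>j. x j $ c" k "\<lambda>j. d j $ c" j] by simp
qed

lemma closedin_SOL:
  fixes A :: "nat \<Rightarrow> 'n::finite list \<Rightarrow> real"
  assumes "k \<ge> 1"
  shows "closedin (vec_tuples_topology k) (SOL m k A d q)"
proof -
  \<comment> \<open>Filling up with zeros embeds the tuples continuously into the function space over all indices.\<close>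
  define e where "e x = (\<lambda>j. if j \<le> k then x j else 0)" for x :: "nat \<Rightarrow> real ^ 'n"
  define Z where "Z = {z. residual m k A z = q} \<inter> {z. \<forall>c. min (z 0 $ c) (z 1 $ c) = 0}
    \<inter> {z. \<forall>j. j \<in> {1..k - 1} \<longrightarrow> (\<forall>c. min (d j $ c - z j $ c) (z (j + 1) $ c) = 0)}"
  have "closed Z"
    unfolding Z_def
    by (intro closed_Int closed_Collect_eq closed_Collect_all closed_Collect_imp open_Collect_const
        continuous_intros continuous_on_residual continuous_on_product_coordinates)
  moreover have "continuous_map (vec_tuples_topology k) (product_topology (\<lambda>_. euclidean) UNIV) e"
    unfolding continuous_map_componentwise_UNIV e_def
    by (auto intro: continuous_map_product_projection)
  ultimately have "closedin (vec_tuples_topology k) {x \<in> topspace (vec_tuples_topology k). e x \<in> Z}"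
    by (intro closedin_continuous_map_preimage[where Y = euclidean])
      (simp_all add: euclidean_product_topology)
  also have "{x \<in> topspace (vec_tuples_topology k). e x \<in> Z} = SOL m k A d q"
  proof -
    have "residual m k A (e x) = residual m k A x" for x
      by (intro residual_cong) (simp add: e_def)
    then have "e x \<in> Z \<longleftrightarrow> tensor_apply m (A 0) (x 0) = q + (\<Sum>j = 1..k. tensor_apply m (A j) (x j)) \<and>
      inf (x 0) (x 1) = 0 \<and> (\<forall>j \<in> {1..k - 1}. inf (d j - x j) (x (j + 1)) = 0)" for x
      using assms by (auto simp: Z_def e_def residual_def vec_eq_iff inf_vec_def inf_min diff_eq_eq)
    then show ?thesis
      by (auto simp: SOL_def)
  qed
  finally show ?thesis .
qed

lemma compactin_SOL:
  fixes A :: "nat \<Rightarrow> 'n::finite list \<Rightarrow> real"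
  assumes m: "m \<ge> 2" and k: "k \<ge> 1" and EHP: "EHP_tensor m k A"
    and d: "\<forall>j\<in>{1..k - 1}. d j \<in> pos_vecs"
  shows "compactin (vec_tuples_topology k) (SOL m k A d q)"
proof -
  obtain R where R: "0 < R"
    "\<And>x. sign_opposed k x \<Longrightarrow> norm (residual m k A x) \<le> norm q \<Longrightarrow> (\<Sum>j\<le>k. norm (x j)) < R"
    using EHP_tensor_bounded[OF EHP m] by metis
  have "SOL m k A d q \<subseteq> {..k} \<rightarrow>\<^sub>E cball 0 R"
  proof
    fix x assume x: "x \<in> SOL m k A d q"
    then have "residual m k A x = q"
      by (simp add: SOL_def residual_def)
    then have sum: "(\<Sum>j\<le>k. norm (x j)) < R"
      using R(2) sign_opposed_SOL[OF k d x] by simp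
    have "norm (x j) \<le> R" if "j \<le> k" for j
    proof -
      have "norm (x j) \<le> (\<Sum>j\<le>k. norm (x j))"
        using that by (intro member_le_sum) auto
      then show ?thesis
        using sum by simp
    qed
    then show "x \<in> {..k} \<rightarrow>\<^sub>E cball 0 R"
      using x by (auto simp: SOL_def PiE_iff)
  qed
  moreover have "compactin (vec_tuples_topology k) ({..k} \<rightarrow>\<^sub>E cball (0 :: real ^ 'n) R)"
    by (simp add: compactin_PiE)
  ultimately show ?thesis
    using closedin_SOL[OF k] closed_compactin by blast
qed

theorem corollary4p6:
  fixes m k :: nat
    and A :: "nat \<Rightarrow> 'n::finite list \<Rightarrow> real"
  assumes "m \<ge> 1" and "even m" and "k \<ge> 1"
    and "\<forall>j \<in> {0..k}. A j \<in> tensors m"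
    and "EHP_tensor m k A"
  shows "\<forall>(d :: nat \<Rightarrow> real ^ 'n) (q :: real ^ 'n). (\<forall>j \<in> {1..k - 1}. d j \<in> pos_vecs) \<longrightarrow>
    SOL m k A d q \<noteq> {} \<and> compactin (vec_tuples_topology k) (SOL m k A d q)"
proof -
  have "m \<ge> 2"
    using assms(1,2) by (cases "m = 1") auto
  then show ?thesis
    using SOL_nonempty compactin_SOL assms by blast
qed

end
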